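(* For every prime $p\geq 5$, there exists a nonschurian association scheme of degree $4p^2$ which is separable.
   Context: Let $\Omega$ be a finite set and $S$ a partition of $\Omega\times\Omega$ into nonempty relations. For $r\subseteq \Omega\times\Omega$ put $r^*=\{(\beta,\alpha):(\alpha,\beta)\in r\}$ and $\alpha r=\{\beta:(\alpha,\beta)\in r\}$. The pair $\mathcal{X}=(\Omega,S)$ is a coherent configuration if: the diagonal $1_\Omega$ of $\Omega\times\Omega$ is a union of classes of $S$; $s^*\in S$ for every $s\in S$; and for all $r,s,t\in S$ the number $c_{rs}^t=|\alpha r\cap \beta s^*|$ does not depend on the choice of $(\alpha,\beta)\in t$. The elements of $S$ are the basis relations, the numbers $c_{rs}^t$ are the intersection numbers, and $|\Omega|$ is the degree of $\mathcal{X}$. If $1_\Omega\in S$, then $\mathcal{X}$ is an association scheme. For $K\leq \mathrm{Sym}(\Omega)$, $\mathrm{Inv}(K)$ is the coherent configuration on $\Omega$ whose basis relations are the orbits of the componentwise action of $K$ on $\Omega\times\Omega$ (the $2$-orbits of $K$). A coherent configuration $\mathcal{X}$ on $\Omega$ is schurian if $\mathcal{X}=\mathrm{Inv}(K)$ for some $K\leq\mathrm{Sym}(\Omega)$, and nonschurian otherwise. Let $\mathcal{X}=(\Omega,S)$ and $\mathcal{X}'=(\Omega',S')$ be coherent configurations. An algebraic isomorphism from $\mathcal{X}$ to $\mathcal{X}'$ is a bijection $\varphi:S\to S'$ with $c_{rs}^t=c_{r^\varphi s^\varphi}^{t^\varphi}$ for all $r,s,t\in S$. A combinatorial isomorphism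 from $\mathcal{X}$ to $\mathcal{X}'$ is a bijection $f:\Omega\to\Omega'$ that maps the basis relations of $\mathcal{X}$ to the basis relations of $\mathcal{X}'$; it induces the algebraic isomorphism $s\mapsto s^f=\{(\alpha^f,\beta^f):(\alpha,\beta)\in s\}$. A coherent configuration $\mathcal{X}$ is separable if every algebraic isomorphism from $\mathcal{X}$ to another coherent configuration is induced by a combinatorial isomorphism. *)

theory Defs
  imports
    "HOL-Library.Disjoint_Sets"
    "HOL-Computational_Algebra.Primes"
    "HOL-Algebra.Group_Action"
begin

locale coherent_configuration =
  fixes \<Omega> :: "'a set" and S :: "('a \<times> 'a) set set"
  assumes finite_points: "finite \<Omega>"
    and partition: "partition_on (\<Omega> \<times> \<Omega>) S"
    and diagonal: "\<exists>D \<subseteq> S. Id_on \<Omega> = \<Union>D"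
    and converse_closed: "s \<in> S \<Longrightarrow> s\<inverse> \<in> S"
    and regular: "\<lbrakk>r \<in> S; s \<in> S; t \<in> S; (\<alpha>, \<beta>) \<in> t; (\<alpha>', \<beta>') \<in> t\<rbrakk> \<Longrightarrow>
      card (r `` {\<alpha>} \<inter> s\<inverse> `` {\<beta>}) = card (r `` {\<alpha>'} \<inter> s\<inverse> `` {\<beta>'})"

locale association_scheme = coherent_configuration +
  assumes diagonal_basis: "Id_on \<Omega> \<in> S"

text \<open>The number \<open>c\<^bsub>rs\<^esub>\<^bsup>t\<^esup>\<close> is \<open>intersection_number r s t\<close>. The description is proper
  whenever \<open>r\<close>, \<open>s\<close>, \<open>t\<close> are basis relations of a coherent configuration: see
  \<open>intersection_number_eq\<close> below.\<close>

definition intersection_number ::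
  "('a \<times> 'a) set \<Rightarrow> ('a \<times> 'a) set \<Rightarrow> ('a \<times> 'a) set \<Rightarrow> nat" where
  "intersection_number r s t =
     (THE c. \<forall>(\<alpha>, \<beta>) \<in> t. card (r `` {\<alpha>} \<inter> s\<inverse> `` {\<beta>}) = c)"

lemma (in coherent_configuration) intersection_number_eq:
  assumes "r \<in> S" "s \<in> S" "t \<in> S" "(\<alpha>, \<beta>) \<in> t"
  shows "intersection_number r s t = card (r `` {\<alpha>} \<inter> s\<inverse> `` {\<beta>})"
  unfolding intersection_number_def
proof (rule the_equality)
  show "\<forall>(\<alpha>', \<beta>') \<in> t. card (r `` {\<alpha>'} \<inter> s\<inverse> `` {\<beta>'}) = card (r `` {\<alpha>} \<inter> s\<inverse> `` {\<beta>})"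
    using assms regular by blast
qed (use assms in auto)

definition two_orbits :: "'a set \<Rightarrow> ('a \<Rightarrow> 'a) set \<Rightarrow> ('a \<times> 'a) set set" where
  "two_orbits \<Omega> K = orbits (BijGroup \<Omega>\<lparr>carrier := K\<rparr>) (\<Omega> \<times> \<Omega>) (\<lambda>k. map_prod k k)"

text \<open>\<open>BijGroup \<Omega>\<close> is the symmetric group of \<open>\<Omega>\<close>. Its elements are undefined outside \<open>\<Omega>\<close>,
  which does not matter for the orbits on \<open>\<Omega> \<times> \<Omega>\<close>.\<close>

definition schurian :: "'a set \<Rightarrow> ('a \<times> 'a) set set \<Rightarrow> bool" where
  "schurian \<Omega> S \<longleftrightarrow> (\<exists>K. subgroup K (BijGroup \<Omega>) \<and> S = two_orbits \<Omega> K)"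

definition algebraic_isomorphism ::
  "('a \<times> 'a) set set \<Rightarrow> ('b \<times> 'b) set set \<Rightarrow> (('a \<times> 'a) set \<Rightarrow> ('b \<times> 'b) set) \<Rightarrow> bool" where
  "algebraic_isomorphism S S' \<phi> \<longleftrightarrow> bij_betw \<phi> S S' \<and>
     (\<forall>r \<in> S. \<forall>s \<in> S. \<forall>t \<in> S.
        intersection_number r s t = intersection_number (\<phi> r) (\<phi> s) (\<phi> t))"

definition rel_image :: "('a \<Rightarrow> 'b) \<Rightarrow> ('a \<times> 'a) set \<Rightarrow> ('b \<times> 'b) set" where
  "rel_image f s = map_prod f f ` s"

definition combinatorial_isomorphism ::
  "'a set \<Rightarrow> ('a \<times> 'a) set set \<Rightarrow> 'b set \<Rightarrow> ('b \<times> 'b) set set \<Rightarrow> ('a \<Rightarrow> 'b) \<Rightarrow> bool" where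
  "combinatorial_isomorphism \<Omega> S \<Omega>' S' f \<longleftrightarrow>
     bij_betw f \<Omega> \<Omega>' \<and> rel_image f ` S = S'"

text \<open>A definition cannot quantify over types, so the second configuration lives on a finite set
  of natural numbers. Since every finite set is in bijection with such a set, this covers
  configurations over arbitrary types: see \<open>separable_any_type\<close> below.\<close>

definition separable :: "'a set \<Rightarrow> ('a \<times> 'a) set set \<Rightarrow> bool" where
  "separable \<Omega> S \<longleftrightarrow>
     (\<forall>(\<Omega>' :: nat set) S' \<phi>.
        coherent_configuration \<Omega>' S' \<longrightarrow> algebraic_isomorphism S S' \<phi> \<longrightarrow>
        (\<exists>f. combinatorial_isomorphism \<Omega> S \<Omega>' S' f \<and> (\<forall>s \<in> S. \<phi> s = rel_image f s)))"

lemma rel_image_comp: "rel_image g (rel_image f s) = rel_image (g \<circ> f) s"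
  unfolding rel_image_def image_image by (rule image_cong) auto

lemma rel_image_id:
  assumes "s \<subseteq> A \<times> A" "\<And>x. x \<in> A \<Longrightarrow> f x = x"
  shows "rel_image f s = s"
proof -
  have "rel_image f s = (\<lambda>x. x) ` s"
    unfolding rel_image_def by (rule image_cong) (use assms in auto)
  then show ?thesis by simp
qed

lemma card_neighbours_rel_image:
  assumes inj: "inj_on g A" and sub: "r \<subseteq> A \<times> A" "s \<subseteq> A \<times> A" and mem: "\<alpha> \<in> A" "\<beta> \<in> A"
  shows "card (rel_image g r `` {g \<alpha>} \<inter> (rel_image g s)\<inverse> `` {g \<beta>}) =
    card (r `` {\<alpha>} \<inter> s\<inverse> `` {\<beta>})"
proof -
  have "rel_image g r `` {g \<alpha>} \<inter> (rel_image g s)\<inverse> `` {g \<beta>} = g ` (r `` {\<alpha>} \<inter> s\<inverse> `` {\<beta>})"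
  proof (intro equalityI subsetI)
    fix y assume "y \<in> rel_image g r `` {g \<alpha>} \<inter> (rel_image g s)\<inverse> `` {g \<beta>}"
    then obtain a b c d where *: "(a, b) \<in> r" "g a = g \<alpha>" "y = g b"
        "(c, d) \<in> s" "g d = g \<beta>" "y = g c"
      by (auto simp: rel_image_def)
    then have "a = \<alpha>" "d = \<beta>" "b = c"
      using inj_onD[OF inj] sub mem by (metis mem_Sigma_iff subsetD)+
    with * show "y \<in> g ` (r `` {\<alpha>} \<inter> s\<inverse> `` {\<beta>})" by blast
  qed (force simp: rel_image_def)
  moreover have "inj_on g (r `` {\<alpha>} \<inter> s\<inverse> `` {\<beta>})"
    by (rule inj_on_subset[OF inj]) (use sub in auto)
  ultimately show ?thesis by (simp add: card_image)
qed

lemma (in coherent_configuration) basis_subset: "s \<in> S \<Longrightarrow> s \<subseteq> \<Omega> \<times> \<Omega>"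
  using partition by (auto simp: partition_on_def)

lemma (in coherent_configuration) transport:
  assumes g: "bij_betw g \<Omega> \<Omega>'"
  shows "coherent_configuration \<Omega>' (rel_image g ` S)"
proof -
  have inj: "inj_on g \<Omega>" and im: "g ` \<Omega> = \<Omega>'"
    using g by (auto simp: bij_betw_def)
  have inj2: "inj_on (map_prod g g) (\<Omega> \<times> \<Omega>)"
    using inj by (auto simp: inj_on_def)
  have im2: "map_prod g g ` (\<Omega> \<times> \<Omega>) = \<Omega>' \<times> \<Omega>'"
    using im by (auto simp: map_prod_def image_iff)
  show ?thesis
  proof
    show "finite \<Omega>'" using finite_points im by blast
    show "partition_on (\<Omega>' \<times> \<Omega>') (rel_image g ` S)"
    proof (rule partition_onI)
      show "\<Union> (rel_image g ` S) = \<Omega>' \<times> \<Omega>'"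
        using partition im2 by (auto simp: partition_on_def rel_image_def simp flip: image_Union)
      fix p q assume "p \<in> rel_image g ` S" "q \<in> rel_image g ` S" "p \<noteq> q"
      then obtain s t where st: "s \<in> S" "t \<in> S" "s \<noteq> t" "p = rel_image g s" "q = rel_image g t"
        by auto
      then have "s \<inter> t = {}"
        using partition by (auto simp: partition_on_def disjoint_def)
      then show "disjnt p q"
        using inj_on_image_Int[OF inj2 basis_subset[OF st(1)] basis_subset[OF st(2)]] st
        by (simp add: disjnt_def rel_image_def)
    next
      show "{} \<notin> rel_image g ` S"
        using partition by (auto simp: partition_on_def rel_image_def)
    qed
    obtain D where D: "D \<subseteq> S" "Id_on \<Omega> = \<Union>D" using diagonal by blast
    have "Id_on \<Omega>' = rel_image g (Id_on \<Omega>)"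
      using im by (auto simp: Id_on_def rel_image_def)
    also have "\<dots> = \<Union> (rel_image g ` D)"
      unfolding D(2) rel_image_def by blast
    finally have "Id_on \<Omega>' = \<Union> (rel_image g ` D)" .
    then show "\<exists>D' \<subseteq> rel_image g ` S. Id_on \<Omega>' = \<Union>D'"
      using image_mono[OF D(1)] by (intro exI[of _ "rel_image g ` D"]) simp
  next
    fix p assume "p \<in> rel_image g ` S"
    then obtain s where s: "s \<in> S" "p = rel_image g s" by blast
    then have "p\<inverse> = rel_image g (s\<inverse>)" by (auto simp: rel_image_def)
    then show "p\<inverse> \<in> rel_image g ` S" using converse_closed[OF s(1)] by simp
  next
    fix r' s' t' a b a' b'
    assume "r' \<in> rel_image g ` S" "s' \<in> rel_image g ` S" "t' \<in> rel_image g ` S"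
      and mem: "(a, b) \<in> t'" "(a', b') \<in> t'"
    then obtain r s t where rst: "r \<in> S" "s \<in> S" "t \<in> S"
        "r' = rel_image g r" "s' = rel_image g s" "t' = rel_image g t" by auto
    obtain x y x' y' where xy: "(x, y) \<in> t" "a = g x" "b = g y" "(x', y') \<in> t" "a' = g x'" "b' = g y'"
      using mem rst by (auto simp: rel_image_def)
    then have "x \<in> \<Omega>" "y \<in> \<Omega>" "x' \<in> \<Omega>" "y' \<in> \<Omega>"
      using basis_subset[OF rst(3)] by auto
    then show "card (r' `` {a} \<inter> s'\<inverse> `` {b}) = card (r' `` {a'} \<inter> s'\<inverse> `` {b'})"
      using regular[OF rst(1-3) xy(1,4)] rst xy basis_subset
      by (simp add: card_neighbours_rel_image[OF inj])
  qed
qed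

lemma (in coherent_configuration) algebraic_isomorphism_transport:
  assumes g: "bij_betw g \<Omega> \<Omega>'"
  shows "algebraic_isomorphism S (rel_image g ` S) (rel_image g)"
proof -
  interpret C': coherent_configuration \<Omega>' "rel_image g ` S" by (rule transport[OF g])
  have inj: "inj_on g \<Omega>" using g by (auto simp: bij_betw_def)
  have "inj_on (map_prod g g) (\<Omega> \<times> \<Omega>)" using inj by (auto simp: inj_on_def)
  then have "inj_on (rel_image g) S"
    unfolding rel_image_def inj_on_def[of _ S]
    using inj_on_image_eq_iff basis_subset by metis
  moreover have "intersection_number r s t =
      intersection_number (rel_image g r) (rel_image g s) (rel_image g t)"
    if rst: "r \<in> S" "s \<in> S" "t \<in> S" for r s t
  proof -
    have "t \<noteq> {}" using partition rst by (auto simp: partition_on_def)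
    then obtain x y where xy: "(x, y) \<in> t" by auto
    then have "(g x, g y) \<in> rel_image g t" by (force simp: rel_image_def)
    moreover have "x \<in> \<Omega>" "y \<in> \<Omega>" using basis_subset[OF rst(3)] xy by auto
    ultimately show ?thesis
      using rst xy basis_subset
      by (simp add: intersection_number_eq[of r s t x y]
          C'.intersection_number_eq[of _ _ _ "g x" "g y"] card_neighbours_rel_image[OF inj])
  qed
  ultimately show ?thesis
    by (auto simp: algebraic_isomorphism_def bij_betw_def)
qed

lemma separable_any_type:
  fixes \<Omega> :: "'a set" and \<Omega>' :: "'b set"
  assumes sep: "separable \<Omega> S" and X: "coherent_configuration \<Omega> S"
    and X': "coherent_configuration \<Omega>' S'"
    and \<phi>: "algebraic_isomorphism S S' \<phi>"
  shows "\<exists>f. combinatorial_isomorphism \<Omega> S \<Omega>' S' f \<and> (\<forall>s \<in> S. \<phi> s = rel_image f s)"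
proof -
  interpret X: coherent_configuration \<Omega> S by (rule X)
  interpret X': coherent_configuration \<Omega>' S' by (rule X')
  obtain g :: "'b \<Rightarrow> nat" where g: "bij_betw g \<Omega>' {0..<card \<Omega>'}"
    using ex_bij_betw_finite_nat[OF X'.finite_points] by blast
  let ?N = "{0..<card \<Omega>'}" and ?T = "rel_image g ` S'" and ?h = "inv_into \<Omega>' g"
  have "algebraic_isomorphism S' ?T (rel_image g)"
    by (rule X'.algebraic_isomorphism_transport[OF g])
  with \<phi> have "algebraic_isomorphism S ?T (rel_image g \<circ> \<phi>)"
    unfolding algebraic_isomorphism_def by (auto intro: bij_betw_trans simp: bij_betw_apply)
  with sep X'.transport[OF g] obtain f where "combinatorial_isomorphism \<Omega> S ?N ?T f"
      and "\<forall>s \<in> S. (rel_image g \<circ> \<phi>) s = rel_image f s"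
    unfolding separable_def by blast
  then have f: "bij_betw f \<Omega> ?N"
      and \<phi>f: "\<And>s. s \<in> S \<Longrightarrow> rel_image g (\<phi> s) = rel_image f s"
    by (auto simp: combinatorial_isomorphism_def)
  have hf: "bij_betw (?h \<circ> f) \<Omega> \<Omega>'"
    using f bij_betw_inv_into[OF g] by (rule bij_betw_trans)
  have img: "\<phi> ` S = S'" using \<phi> by (auto simp: algebraic_isomorphism_def bij_betw_def)
  have eq: "\<phi> s = rel_image (?h \<circ> f) s" if s: "s \<in> S" for s
  proof -
    have "\<phi> s \<subseteq> \<Omega>' \<times> \<Omega>'" using X'.basis_subset img s by blast
    then have "rel_image (?h \<circ> g) (\<phi> s) = \<phi> s"
      by (rule rel_image_id) (use g in \<open>simp add: bij_betw_inv_into_left\<close>)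
    then show ?thesis using \<phi>f[OF s] by (metis rel_image_comp)
  qed
  then have "rel_image (?h \<circ> f) ` S = S'" using img by (simp cong: image_cong)
  with hf eq show ?thesis unfolding combinatorial_isomorphism_def by blast
qed

end

theory Submission
  imports Defs "HOL-Library.Z2" "HOL-Library.Product_Plus"
begin

text \<open>
  Write \<open>E\<close> for the Klein four-group and \<open>V = (\<int>/p)\<^sup>2\<close>, and take for every nonzero \<open>a\<close> in \<open>E\<close>
  a linear form \<open>\<lambda>\<^sub>a\<close> on \<open>V\<close>: the coordinates \<open>x\<close> and \<open>y\<close> and their sum \<open>x + y\<close>. Any two of the
  three forms are independent. The point set is \<open>E \<times> V\<close>, seen as four blocks, each a copy of \<open>V\<close>,
  and the colour of a pair of points \<open>(i, v)\<close>, \<open>(j, w)\<close> is \<open>i - j\<close> together with \<open>w - v\<close> if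
  \<open>i = j\<close>, and with \<open>\<lambda>\<^sub>a (w - v)\<close> for \<open>a = i - j\<close> otherwise. The colour classes form an association
  scheme, because two independent forms on \<open>V\<close> take any two prescribed values at a common point.

  Inside a block all relations are thin, so a map that preserves each block and the colours
  inside the blocks is a translation on each block, and the only freedom is the choice of four
  translation vectors \<open>v\<^sub>i\<close>. Both questions are therefore about the linear map
  \<open>(v\<^sub>i)\<^sub>i \<mapsto> (\<lambda>\<^bsub>i+j\<^esub> (v\<^sub>i - v\<^sub>j))\<^bsub>i<j\<^esub>\<close> from \<open>V\<^sup>4\<close> to the space of dimension six. A linear
  relation between its six components has at each block \<open>i\<close> coefficients proportional to those
  of \<open>\<lambda>\<^sub>1 + \<lambda>\<^sub>2 - \<lambda>\<^sub>3 = 0\<close>, and going around a triangle of blocks multiplies them by \<open>-1\<close>. For odd \<open>p\<close>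
  there is hence only the trivial relation: the map is onto, and its kernel has dimension two.

  \<^item> The kernel consists of the diagonal translations. A colour-preserving permutation that fixes
    a point preserves every block, since colours record the difference of the blocks. Hence it is
    the identity, whereas a point has \<open>p\<close> neighbours of the same colour in each other block. So the
    scheme is not schurian: \<open>klein_scheme_not_homogeneous\<close>.
  \<^item> Given an algebraic isomorphism to another configuration, the latter also consists of four
    blocks with thin relations, and its relations between two blocks are determined by \<open>\<lambda>\<^sub>a\<close> up to
    an additive constant for each pair of blocks. As the linear map is onto, base points
    in the blocks can be chosen that make all six constants agree with the original scheme.
    So the scheme is separable: \<open>anchors_exist\<close>, \<open>induced\<close>.
\<close>

section \<open>Homogeneity and transport along bijections\<close>

lemma (in coherent_configuration) basis_relation_eqI:
  assumes "s \<in> S" "t \<in> S" "(u, v) \<in> s" "(u, v) \<in> t"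
  shows "s = t"
  using assms partition unfolding partition_on_def disjoint_def by blast

text \<open>A 2-orbit is the orbit of each of its pairs, so the permutation group of a schurian
  configuration takes any pair of a basis relation to any other.\<close>

lemma (in coherent_configuration) schurian_homogeneous:
  assumes "schurian \<Omega> S" "s \<in> S" "(u, v) \<in> s" "(u', v') \<in> s"
  shows "\<exists>k. k u = u' \<and> k v = v' \<and> (\<forall>t \<in> S. \<forall>(x, y) \<in> t. (k x, k y) \<in> t)"
proof -
  obtain K where K: "subgroup K (BijGroup \<Omega>)" "S = two_orbits \<Omega> K"
    using assms(1) by (auto simp: schurian_def)
  have orbit: "t = {(k x, k y) | k. k \<in> K}" if t: "t \<in> S" and xy: "(x, y) \<in> t" for t x y
  proof -
    let ?o = "{(k x, k y) | k. k \<in> K}"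
    have dom: "x \<in> \<Omega>" "y \<in> \<Omega>" using basis_subset[OF t] xy by auto
    have "?o = orbit (BijGroup \<Omega>\<lparr>carrier := K\<rparr>) (\<lambda>k. map_prod k k) (x, y)"
      by (auto simp: orbit_def)
    then have "?o \<in> S" using dom by (auto simp: K(2) two_orbits_def orbits_def)
    moreover have "(\<lambda>z \<in> \<Omega>. z) \<in> K"
      using subgroup.one_closed[OF K(1)] by (simp add: BijGroup_def)
    then have "((\<lambda>z \<in> \<Omega>. z) x, (\<lambda>z \<in> \<Omega>. z) y) \<in> ?o" by blast
    then have "(x, y) \<in> ?o" using dom by simp
    ultimately show "t = ?o" using basis_relation_eqI t xy by blast
  qed
  obtain k where "k \<in> K" "k u = u'" "k v = v'"
    using orbit[OF assms(2,3)] assms(4) by auto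
  moreover have "(k x, k y) \<in> t" if "t \<in> S" "(x, y) \<in> t" for t x y
    using orbit[OF that] \<open>k \<in> K\<close> by blast
  ultimately show ?thesis by blast
qed

text \<open>A schurian copy makes the configuration itself homogeneous: it suffices to conjugate single
  permutations by \<open>g\<close>, without building a permutation group on \<open>\<Omega>\<close>.\<close>

lemma (in coherent_configuration) schurian_copy_homogeneous:
  assumes g: "bij_betw g \<Omega> \<Omega>'" and schur: "schurian \<Omega>' (rel_image g ` S)"
    and s: "s \<in> S" "(u, v) \<in> s" "(u', v') \<in> s"
  shows "\<exists>k. k u = u' \<and> k v = v' \<and> (\<forall>t \<in> S. \<forall>(x, y) \<in> t. (k x, k y) \<in> t)"
proof -
  interpret Y: coherent_configuration \<Omega>' "rel_image g ` S" by (rule transport[OF g])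
  let ?h = "inv_into \<Omega> g"
  have h: "?h (g x) = x" if "x \<in> \<Omega>" for x
    using bij_betw_inv_into_left[OF g that] .
  have image: "(g x, g y) \<in> rel_image g t" if "(x, y) \<in> t" for x y t
    using that by (force simp: rel_image_def)
  obtain k where k: "k (g u) = g u'" "k (g v) = g v'"
      and pres: "\<forall>t \<in> rel_image g ` S. \<forall>(x, y) \<in> t. (k x, k y) \<in> t"
    using Y.schurian_homogeneous[OF schur imageI[OF s(1)] image[OF s(2)] image[OF s(3)]] by blast
  have "(?h (k (g x)), ?h (k (g y))) \<in> t" if t: "t \<in> S" "(x, y) \<in> t" for t x y
  proof -
    have "(k (g x), k (g y)) \<in> rel_image g t" using pres t image by blast
    then show ?thesis using h basis_subset[OF t(1)] by (auto simp: rel_image_def)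
  qed
  moreover have "u' \<in> \<Omega>" "v' \<in> \<Omega>" using basis_subset[OF s(1)] s(3) by auto
  ultimately show ?thesis using k h by (intro exI[of _ "\<lambda>x. ?h (k (g x))"]) auto
qed

lemma (in association_scheme) transport_association_scheme:
  assumes g: "bij_betw g \<Omega> \<Omega>'"
  shows "association_scheme \<Omega>' (rel_image g ` S)"
proof -
  have "Id_on \<Omega>' = rel_image g (Id_on \<Omega>)"
    using bij_betw_imp_surj_on[OF g] by (force simp: Id_on_def rel_image_def)
  then have "Id_on \<Omega>' \<in> rel_image g ` S" using diagonal_basis by blast
  then show ?thesis using transport[OF g]
    by (simp add: association_scheme_def association_scheme_axioms_def)
qed

lemma (in coherent_configuration) separable_transport:
  assumes g: "bij_betw g \<Omega> \<Omega>'" and sep: "separable \<Omega> S"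
  shows "separable \<Omega>' (rel_image g ` S)"
  unfolding separable_def
proof (intro allI impI)
  fix \<Omega>'' :: "nat set" and S' \<phi>
  assume X': "coherent_configuration \<Omega>'' S'"
    and \<phi>: "algebraic_isomorphism (rel_image g ` S) S' \<phi>"
  have "algebraic_isomorphism S S' (\<phi> \<circ> rel_image g)"
    using algebraic_isomorphism_transport[OF g] \<phi>
    unfolding algebraic_isomorphism_def by (auto intro: bij_betw_trans)
  then obtain f where f: "bij_betw f \<Omega> \<Omega>''" "rel_image f ` S = S'"
      and \<phi>f: "\<forall>s \<in> S. (\<phi> \<circ> rel_image g) s = rel_image f s"
    using sep X' unfolding separable_def combinatorial_isomorphism_def by blast
  let ?f = "f \<circ> inv_into \<Omega> g"
  have image: "rel_image ?f (rel_image g s) = rel_image f s" if s: "s \<in> S" for s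
  proof -
    have "map_prod ?f ?f (map_prod g g z) = map_prod f f z" if "z \<in> s" for z
      using basis_subset[OF s] that bij_betw_inv_into_left[OF g] by (cases z) auto
    then show ?thesis unfolding rel_image_def image_image by (rule image_cong[OF refl])
  qed
  have "\<forall>s \<in> rel_image g ` S. \<phi> s = rel_image ?f s" using \<phi>f image by simp
  moreover have "rel_image ?f ` rel_image g ` S = S'"
    using image f(2) by (simp add: image_image cong: image_cong)
  moreover have "bij_betw ?f \<Omega>' \<Omega>''" by (rule bij_betw_trans[OF bij_betw_inv_into[OF g] f(1)])
  ultimately show "\<exists>f. combinatorial_isomorphism \<Omega>' (rel_image g ` S) \<Omega>'' S' f \<and>
      (\<forall>s \<in> rel_image g ` S. \<phi> s = rel_image f s)"
    unfolding combinatorial_isomorphism_def by blast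
qed

section \<open>Algebraic isomorphisms of association schemes\<close>

locale scheme_isomorphism =
  X: association_scheme \<Omega> S + X': coherent_configuration \<Omega>' S'
  for \<Omega> :: "'a set" and S and \<Omega>' :: "'b set" and S' +
  fixes \<phi>
  assumes iso: "algebraic_isomorphism S S' \<phi>"
begin

lemma image_basis: "s \<in> S \<Longrightarrow> \<phi> s \<in> S'"
  using iso by (auto simp: algebraic_isomorphism_def bij_betw_def)

lemma eq_if_images_meet: "\<lbrakk>s \<in> S; t \<in> S; (u, v) \<in> \<phi> s; (u, v) \<in> \<phi> t\<rbrakk> \<Longrightarrow> s = t"
  using iso X'.basis_relation_eqI image_basis
  by (metis algebraic_isomorphism_def bij_betw_def inj_onD)

lemma image_covers:
  assumes "u \<in> \<Omega>'" "v \<in> \<Omega>'"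
  shows "\<exists>s \<in> S. (u, v) \<in> \<phi> s"
proof -
  have "\<Union> (\<phi> ` S) = \<Omega>' \<times> \<Omega>'"
    using iso X'.partition by (auto simp: algebraic_isomorphism_def bij_betw_def partition_on_def)
  then show ?thesis using assms by blast
qed

text \<open>Of the intersection numbers only their vanishing matters here: a triple of basis relations is
  realised by a triangle in one configuration exactly if it is in the other, and then over
  every edge with the right relation.\<close>

lemma triangle_iff:
  assumes rst: "r \<in> S" "s \<in> S" "t \<in> S" and xz: "(x, z) \<in> t" and uw: "(u, w) \<in> \<phi> t"
  shows "(\<exists>y. (x, y) \<in> r \<and> (y, z) \<in> s) \<longleftrightarrow> (\<exists>v. (u, v) \<in> \<phi> r \<and> (v, w) \<in> \<phi> s)"
proof -
  have "finite r" "finite (\<phi> r)"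
    using X.basis_subset[OF rst(1)] X'.basis_subset[OF image_basis[OF rst(1)]]
      X.finite_points X'.finite_points by (meson finite_SigmaI finite_subset)+
  then have fin: "finite (r `` {x} \<inter> s\<inverse> `` {z})" "finite (\<phi> r `` {u} \<inter> (\<phi> s)\<inverse> `` {w})"
    by auto
  have "card (r `` {x} \<inter> s\<inverse> `` {z}) = intersection_number r s t"
    using X.intersection_number_eq[OF rst xz] by simp
  also have "\<dots> = intersection_number (\<phi> r) (\<phi> s) (\<phi> t)"
    using iso rst by (auto simp: algebraic_isomorphism_def)
  also have "\<dots> = card (\<phi> r `` {u} \<inter> (\<phi> s)\<inverse> `` {w})"
    using X'.intersection_number_eq[OF _ _ _ uw] rst image_basis by simp
  finally have "r `` {x} \<inter> s\<inverse> `` {z} \<noteq> {} \<longleftrightarrow> \<phi> r `` {u} \<inter> (\<phi> s)\<inverse> `` {w} \<noteq> {}"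
    using fin card_0_eq by metis
  then show ?thesis by blast
qed

lemma basis_nonempty: "s \<in> S \<Longrightarrow> \<exists>x y. (x, y) \<in> s"
  using X.partition by (auto simp: partition_on_def) (metis ex_in_conv surj_pair)

text \<open>The image of the diagonal is a single basis relation, whereas the diagonal of the second
  configuration could split a priori. Both inclusions follow from degenerate triangles.\<close>

lemma image_diagonal: "\<phi> (Id_on \<Omega>) = Id_on \<Omega>'"
proof -
  have diag: "v = u" if uv: "(u, v) \<in> \<phi> (Id_on \<Omega>)" for u v
  proof -
    have dom: "u \<in> \<Omega>'" "v \<in> \<Omega>'"
      using X'.basis_subset[OF image_basis[OF X.diagonal_basis]] uv by auto
    obtain D where D: "D \<subseteq> S'" "Id_on \<Omega>' = \<Union>D" using X'.diagonal by blast
    then obtain d where d: "d \<in> D" "(u, u) \<in> d" using dom by blast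
    obtain t where t: "t \<in> S" "\<phi> t = d"
      using iso d D by (auto simp: algebraic_isomorphism_def bij_betw_def)
    obtain x z where xz: "(x, z) \<in> Id_on \<Omega>" using basis_nonempty[OF X.diagonal_basis] by blast
    obtain y where "(x, y) \<in> t" "(y, z) \<in> Id_on \<Omega>"
      using triangle_iff[OF t(1) X.diagonal_basis X.diagonal_basis xz uv] uv d t by blast
    then have "t = Id_on \<Omega>"
      using X.basis_relation_eqI[OF t(1) X.diagonal_basis] xz by auto
    then have "(u, v) \<in> Id_on \<Omega>'" using uv t d D by blast
    then show "v = u" by auto
  qed
  moreover have "(u, u) \<in> \<phi> (Id_on \<Omega>)" if u: "u \<in> \<Omega>'" for u
  proof -
    obtain s where s: "s \<in> S" "(u, u) \<in> \<phi> s" using image_covers u by blast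
    obtain x z where xz: "(x, z) \<in> s" using basis_nonempty[OF s(1)] by blast
    have "(x, x) \<in> Id_on \<Omega>" using X.basis_subset[OF s(1)] xz by auto
    then obtain v where "(u, v) \<in> \<phi> (Id_on \<Omega>)"
      using triangle_iff[OF X.diagonal_basis s(1) s(1) xz s(2)] xz by blast
    then show ?thesis using diag by blast
  qed
  ultimately show ?thesis
    using X'.basis_subset[OF image_basis[OF X.diagonal_basis]] by (auto simp: Id_on_def) 
qed

lemma image_converse:
  assumes s: "s \<in> S" and uv: "(u, v) \<in> \<phi> s"
  shows "(v, u) \<in> \<phi> (s\<inverse>)"
proof -
  have dom: "u \<in> \<Omega>'" "v \<in> \<Omega>'" using X'.basis_subset[OF image_basis[OF s]] uv by auto
  obtain t where t: "t \<in> S" "(v, u) \<in> \<phi> t" using image_covers dom by blast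
  obtain x where x: "(x, x) \<in> Id_on \<Omega>" using basis_nonempty[OF X.diagonal_basis] by auto
  have "(u, u) \<in> \<phi> (Id_on \<Omega>)" using dom image_diagonal by auto
  then obtain y where "(x, y) \<in> s" "(y, x) \<in> t"
    using triangle_iff[OF s t(1) X.diagonal_basis x] uv t(2) by blast
  then have "s\<inverse> = t" using X.basis_relation_eqI[OF X.converse_closed[OF s] t(1)] by auto
  then show ?thesis using t(2) by simp
qed

end

section \<open>Colours of displacements\<close>

text \<open>The first component, an element of the Klein four-group, is the block. The other two
  are integers that represent residues.\<close>

type_synonym vec = "(bit \<times> bit) \<times> int \<times> int"

fun reduce :: "int \<Rightarrow> vec \<Rightarrow> vec" where
  "reduce m (a, x, y) = (a, x mod m, y mod m)"

text \<open>The colour of a pair of points is the colour of their difference. Between different blocks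
  it is the value of the form \<open>i * x + j * y\<close>, that is \<open>x\<close>, \<open>y\<close> or \<open>x + y\<close>; the \<open>0\<close> in
  this case only fills the last component.\<close>

fun colour :: "int \<Rightarrow> vec \<Rightarrow> vec" where
  "colour m ((i, j), x, y) =
     ((i, j), if i = 0 \<and> j = 0 then (x mod m, y mod m)
              else ((of_bool (i = 1) * x + of_bool (j = 1) * y) mod m, 0))"

lemma mod_eq_if_diff_eq:
  fixes m :: int
  assumes "x mod m = y mod m" "s - t = x - y"
  shows "s mod m = t mod m"
  using assms by (metis mod_eq_dvd_iff)

lemma mod_add_left_cancel: "(a + x) mod m = (a + y) mod m \<longleftrightarrow> x mod m = y mod m" for m :: int
  by (metis add_diff_cancel_left mod_eq_dvd_iff)

lemma fst_colour [simp]: "fst (colour m g) = fst g"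
  by (cases "(m, g)" rule: colour.cases) simp

lemma fst_reduce [simp]: "fst (reduce m g) = fst g"
  by (cases g) simp

lemma colour_reduce [simp]: "colour m (reduce m g) = colour m g"
  by (cases "(m, g)" rule: colour.cases) (auto simp: mod_simps)

lemma colour_uminus:
  assumes "colour m g = colour m h"
  shows "colour m (- g) = colour m (- h)"
  using assms
  by (cases "(m, g)" rule: colour.cases; cases "(m, h)" rule: colour.cases)
    (auto elim: mod_eq_if_diff_eq[OF sym] split: if_splits)

lemma colour_zero [simp]: "colour m (0, x, y) = (0, x mod m, y mod m)"
  using colour.simps[of m 0 0 x y] by (simp add: zero_prod_def)

lemma colour_block [simp]: "colour m (a, 0) = (a, 0)"
  by (cases a) (simp add: zero_prod_def)

text \<open>A displacement with block \<open>0\<close> is determined by its colour modulo \<open>m\<close>, and all forms are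
  linear. For two displacements with distinct nonzero blocks this fails: the colours of the summands
  determine only the block of the sum.\<close>

lemma colour_add_thin:
  assumes "colour m g = colour m g'" "colour m h = colour m h'" "fst g = 0"
  shows "colour m (g + h) = colour m (g' + h')"
proof -
  obtain x y where g: "g = (0, x, y)" using assms(3) by (cases g) auto
  obtain x' y' where g': "g' = (0, x', y')"
    using arg_cong[OF assms(1), of fst] unfolding g by (cases g') simp
  obtain i j z w where h: "h = ((i, j), z, w)" by (metis prod.exhaust)
  obtain z' w' where h': "h' = ((i, j), z', w')"
    using arg_cong[OF assms(2), of fst] unfolding h by (cases h') simp
  have "((x + z) + (y + w)) mod m = ((x' + z') + (y' + w')) mod m"
    if "x mod m = x' mod m" "y mod m = y' mod m" "(z + w) mod m = (z' + w') mod m"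
    using mod_add_cong[OF mod_add_cong[OF that(1,2)] that(3)] by (simp add: ac_simps)
  then show ?thesis using assms(1,2) unfolding g g' h h'
    by (cases i; cases j; simp) (auto intro: mod_add_cong)
qed

text \<open>This is what makes the configuration coherent. Let \<open>A\<close> be the block of \<open>g\<close> and \<open>g'\<close>, let
  \<open>d = g' - g\<close>, and let \<open>\<lambda>\<^sub>C\<close> be the form for block \<open>C\<close>, with \<open>\<lambda>\<^sub>0\<close> the identity of the plane. Then \<open>t\<close>
  has to satisfy \<open>\<lambda>\<^sub>B t = 0\<close> and \<open>\<lambda>\<^bsub>A+B\<^esub> t = \<lambda>\<^bsub>A+B\<^esub> d\<close>, where \<open>\<lambda>\<^sub>A d = 0\<close> is known. If \<open>A\<close> and \<open>B\<close> are distinct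
  and nonzero, these are two independent linear equations in the plane modulo \<open>m\<close>. If \<open>B = 0\<close> or \<open>A = 0\<close>,
  then \<open>t = 0\<close> solves them, and if \<open>A = B\<close>, then \<open>t = d\<close> does.\<close>

lemma colour_translate:
  assumes "colour m g = colour m g'"
  shows "\<exists>t. \<forall>h. fst h = B \<longrightarrow>
    colour m (h + t) = colour m h \<and> colour m (g' - (h + t)) = colour m (g - h)"
proof -
  obtain a b x y where g: "g = ((a, b), x, y)" by (metis prod.exhaust)
  obtain x' y' where g': "g' = ((a, b), x', y')"
    using arg_cong[OF assms(1), of fst] unfolding g by (cases g') simp
  obtain i j where B: "B = (i, j)" by (metis prod.exhaust)
  define dx where "dx = x' - x"
  define dy where "dy = y' - y"
  \<comment> \<open>\<open>(r, s)\<close> is the solution of the two equations, for each choice of the blocks.\<close>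
  define r where "r = (if i = 0 \<and> j = 0 \<or> a = 0 \<and> b = 0 then 0 else if i = a \<and> j = b then dx
     else if j = 0 then 0 else if i = 0 then (if b = 0 then dx + dy else dx)
     else if b = 0 then - dy else dx)"
  define s where "s = (if i = 0 \<and> j = 0 \<or> a = 0 \<and> b = 0 then 0 else if i = a \<and> j = b then dy
     else if i = 0 then 0 else if j = 0 then (if a = 0 then dx + dy else dy)
     else if b = 0 then dy else - dx)"
  have sum: "(x + y) mod m = (x' + y') mod m" if "x mod m = x' mod m" "y mod m = y' mod m"
    using that by (intro mod_add_cong)
  have "colour m (((i, j), p, q) + (0, r, s)) = colour m ((i, j), p, q) \<and>
      colour m (g' - (((i, j), p, q) + (0, r, s))) = colour m (g - ((i, j), p, q))" for p q
    using assms sum unfolding g g' r_def s_def dx_def dy_def zero_prod_def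
    by (cases a; cases b; cases i; cases j; simp)
      (auto simp: algebra_simps elim: mod_eq_if_diff_eq[OF sym])
  then show ?thesis unfolding B by (intro exI[of _ "(0, r, s)"]) auto
qed

section \<open>The scheme\<close>

definition points :: "int \<Rightarrow> vec set" where
  "points m = UNIV \<times> {0..<m} \<times> {0..<m}"

definition basis_relation :: "int \<Rightarrow> vec \<Rightarrow> (vec \<times> vec) set" where
  "basis_relation m g = {(u, v) \<in> points m \<times> points m. colour m (v - u) = colour m g}"

definition klein_scheme :: "int \<Rightarrow> (vec \<times> vec) set set" where
  "klein_scheme m = range (basis_relation m)"

lemma UNIV_blocks: "(UNIV :: (bit \<times> bit) set) = {(0, 0), (0, 1), (1, 0), (1, 1)}"
proof (rule UNIV_eq_I)
  show "x \<in> {(0, 0), (0, 1), (1, 0), (1, 1)}" for x :: "bit \<times> bit"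
    by (cases x; cases "fst x"; cases "snd x") simp_all
qed

lemma finite_points: "finite (points m)"
  unfolding points_def UNIV_blocks by (intro finite_cartesian_product) simp_all

lemma card_points: "m \<ge> 0 \<Longrightarrow> card (points m) = 4 * nat m ^ 2"
  unfolding points_def UNIV_blocks by (simp only: card_cartesian_product) (simp add: power2_eq_square)

lemma reduce_point: "u \<in> points m \<Longrightarrow> reduce m u = u"
  by (auto simp: points_def)

lemma reduce_in_points: "m > 0 \<Longrightarrow> reduce m u \<in> points m"
  by (cases u) (auto simp: points_def)

lemma reduce_inject_translate:
  assumes "reduce m (a + u) = reduce m (a + v)" "u \<in> points m" "v \<in> points m"
  shows "u = v"
proof -
  have "reduce m u = reduce m v"
    using assms(1) by (cases a; cases u; cases v) (simp add: mod_add_left_cancel)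
  then show ?thesis using assms(2,3) by (simp add: reduce_point)
qed

lemma colour_cong: "reduce m g = reduce m h \<Longrightarrow> colour m g = colour m h"
  using colour_reduce[of m g] colour_reduce[of m h] by simp

lemma colour_diff_reduce [simp]:
  "colour m (reduce m v - u) = colour m (v - u)"
  "colour m (v - reduce m u) = colour m (v - u)"
  by (rule colour_cong, cases u, cases v, simp add: mod_simps)
    (rule colour_cong, cases u, cases v, simp add: mod_simps)

lemma colour_eq_zero_iff:
  assumes "u \<in> points m" "v \<in> points m"
  shows "colour m (v - u) = colour m 0 \<longleftrightarrow> u = v"
proof
  assume eq: "colour m (v - u) = colour m 0"
  obtain x y where vu: "v - u = (0, x, y)"
    using arg_cong[OF eq, of fst] by (cases "v - u") (simp add: zero_prod_def)
  then have "reduce m (- u + v) = reduce m (- u + u)"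
    using eq by (simp add: zero_prod_def[where 'a = "bit \<times> bit"] zero_prod_def[where 'a = int])
  then show "u = v" using reduce_inject_translate assms by metis
qed simp

lemma basis_relation_eq_iff:
  assumes "m > 0"
  shows "basis_relation m g = basis_relation m h \<longleftrightarrow> colour m g = colour m h"
proof
  assume *: "basis_relation m g = basis_relation m h"
  have "(reduce m 0, reduce m g) \<in> basis_relation m g"
    using assms by (simp add: basis_relation_def reduce_in_points)
  then have "(reduce m 0, reduce m g) \<in> basis_relation m h" using * by simp
  then show "colour m g = colour m h" by (simp add: basis_relation_def)
qed (simp add: basis_relation_def)

text \<open>The intermediate points \<open>w\<close> all lie in one block, the one that \<open>g\<close> leads to. A single
  translation therefore carries them to intermediate points between \<open>u'\<close> and \<open>v'\<close>.\<close>

lemma card_paths_le: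
  assumes "m > 0" "colour m (v - u) = colour m (v' - u')" "u' \<in> points m" "v' \<in> points m"
  shows "card (basis_relation m g `` {u} \<inter> (basis_relation m h)\<inverse> `` {v})
    \<le> card (basis_relation m g `` {u'} \<inter> (basis_relation m h)\<inverse> `` {v'})"
proof -
  obtain t where t: "fst d = fst g \<longrightarrow>
      colour m (d + t) = colour m d \<and> colour m (v' - u' - (d + t)) = colour m (v - u - d)" for d
    using colour_translate[OF assms(2)] by metis
  let ?f = "\<lambda>w. reduce m ((u' - u + t) + w)"
  show ?thesis
  proof (rule card_inj_on_le[of ?f])
    show "inj_on ?f (basis_relation m g `` {u} \<inter> (basis_relation m h)\<inverse> `` {v})"
      by (rule inj_onI, rule reduce_inject_translate) (auto simp: basis_relation_def)
    show "?f ` (basis_relation m g `` {u} \<inter> (basis_relation m h)\<inverse> `` {v})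
      \<subseteq> basis_relation m g `` {u'} \<inter> (basis_relation m h)\<inverse> `` {v'}"
    proof (intro image_subsetI)
      fix w assume "w \<in> basis_relation m g `` {u} \<inter> (basis_relation m h)\<inverse> `` {v}"
      then have w: "colour m (w - u) = colour m g" "colour m (v - w) = colour m h"
        by (auto simp: basis_relation_def)
      have "fst (w - u) = fst g" using arg_cong[OF w(1), of fst] by (simp only: fst_colour)
      then have t': "colour m (w - u + t) = colour m (w - u)"
          "colour m (v' - u' - (w - u + t)) = colour m (v - u - (w - u))"
        using t by blast+
      have "colour m (w - u + t) = colour m g" "colour m (v' - u' - (w - u + t)) = colour m h"
        unfolding t' using w by simp_all
      then show "?f w \<in> basis_relation m g `` {u'} \<inter> (basis_relation m h)\<inverse> `` {v'}"
        using assms by (simp add: basis_relation_def reduce_in_points algebra_simps)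
    qed
    show "finite (basis_relation m g `` {u'} \<inter> (basis_relation m h)\<inverse> `` {v'})"
      by (rule finite_subset[OF _ finite_points[of m]]) (auto simp: basis_relation_def)
  qed
qed

lemma Id_on_points: "Id_on (points m) = basis_relation m 0"
proof -
  have "(u, v) \<in> Id_on (points m) \<longleftrightarrow> (u, v) \<in> basis_relation m 0" for u v
    using colour_eq_zero_iff[of u m v] unfolding basis_relation_def Id_on_iff by blast
  then show ?thesis by (intro subset_antisym subrelI) blast+
qed

lemma converse_basis_relation: "(basis_relation m g)\<inverse> = basis_relation m (- g)"
proof -
  have "(u, v) \<in> (basis_relation m g)\<inverse> \<longleftrightarrow> (u, v) \<in> basis_relation m (- g)" for u v
    using colour_uminus[of m "u - v" g] colour_uminus[of m "v - u" "- g"]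
    unfolding basis_relation_def by auto
  then show ?thesis by (intro subset_antisym subrelI) blast+
qed

lemma association_scheme_klein_scheme:
  assumes m: "m > 0"
  shows "association_scheme (points m) (klein_scheme m)"
proof -
  have Id_in: "Id_on (points m) \<in> klein_scheme m" by (simp add: Id_on_points klein_scheme_def)
  show ?thesis
  proof
    show "finite (points m)" by (rule finite_points)
    show "partition_on (points m \<times> points m) (klein_scheme m)"
    proof (rule partition_onI)
      show "\<Union> (klein_scheme m) = points m \<times> points m"
        by (auto simp: klein_scheme_def basis_relation_def)
      show "disjnt r s" if rs: "r \<in> klein_scheme m" "s \<in> klein_scheme m" "r \<noteq> s" for r s
      proof -
        obtain g h where gh: "r = basis_relation m g" "s = basis_relation m h"
          using rs(1,2) unfolding klein_scheme_def by blast
        have "r = s" if "z \<in> r" "z \<in> s" for z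
          using that unfolding gh basis_relation_def by force
        then show ?thesis using rs(3) unfolding disjnt_def by blast
      qed
      have "(reduce m 0, reduce m g) \<in> basis_relation m g" for g
        using m by (simp add: basis_relation_def reduce_in_points)
      then show "{} \<notin> klein_scheme m" unfolding klein_scheme_def by blast
    qed
    show "\<exists>D \<subseteq> klein_scheme m. Id_on (points m) = \<Union>D"
      by (rule exI[of _ "{Id_on (points m)}"]) (use Id_in in simp)
    show "Id_on (points m) \<in> klein_scheme m" by (rule Id_in)
    show "s\<inverse> \<in> klein_scheme m" if s: "s \<in> klein_scheme m" for s
    proof -
      obtain g where "s = basis_relation m g" using s unfolding klein_scheme_def by blast
      then have "s\<inverse> = basis_relation m (- g)" by (simp only: converse_basis_relation)
      then show ?thesis by (simp add: klein_scheme_def)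
    qed
    show "card (r `` {u} \<inter> s\<inverse> `` {v}) = card (r `` {u'} \<inter> s\<inverse> `` {v'})"
      if rst: "r \<in> klein_scheme m" "s \<in> klein_scheme m" "t \<in> klein_scheme m"
        and mem: "(u, v) \<in> t" "(u', v') \<in> t" for r s t u v u' v'
    proof -
      obtain g h where gh: "r = basis_relation m g" "s = basis_relation m h"
        using rst unfolding klein_scheme_def by blast
      have "colour m (v - u) = colour m (v' - u')" "u \<in> points m" "v \<in> points m"
          "u' \<in> points m" "v' \<in> points m"
        using rst(3) mem unfolding klein_scheme_def basis_relation_def by fastforce+
      then show ?thesis unfolding gh using m by (intro antisym card_paths_le) auto
    qed
  qed
qed

section \<open>The scheme is not schurian\<close>

text \<open>The pairs from the origin to \<open>((1, 0), 0, 0)\<close> and to \<open>((1, 0), 0, 1)\<close> have the same colour, but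
  no colour-preserving map takes one to the other. Its values at the origins of the two
  remaining blocks would have to satisfy five linear congruences, and adding these with
  suitable signs gives \<open>2 = 0\<close> modulo \<open>m\<close>.\<close>

lemma klein_scheme_not_homogeneous:
  assumes m: "m > 1" "odd m"
    and k: "\<And>t u v. t \<in> klein_scheme m \<Longrightarrow> (u, v) \<in> t \<Longrightarrow> (k u, k v) \<in> t"
    and k0: "k ((0, 0), 0, 0) = ((0, 0), 0, 0)" and k1: "k ((1, 0), 0, 0) = ((1, 0), 0, 1)"
  shows False
proof -
  have col: "colour m (k v - k u) = colour m (v - u)" if "u \<in> points m" "v \<in> points m" for u v
    using k[of "basis_relation m (v - u)" u v] that by (simp add: basis_relation_def klein_scheme_def)
  have P: "((i, j), 0, 0) \<in> points m" for i j using m by (simp add: points_def)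
  note eq = col[OF P[of 0 0] P[of 0 1]] col[OF P[of 0 0] P[of 1 1]] col[OF P[of 1 0] P[of 0 1]]
    col[OF P[of 1 0] P[of 1 1]] col[OF P[of 0 1] P[of 1 1]]
  obtain a b where w2: "k ((0, 1), 0, 0) = ((0, 1), a, b)"
    using eq(1)[unfolded k0, THEN arg_cong, of fst]
    by (cases "k ((0, 1), 0, 0)") (simp flip: zero_prod_def)
  obtain c d where w3: "k ((1, 1), 0, 0) = ((1, 1), c, d)"
    using eq(2)[unfolded k0, THEN arg_cong, of fst]
    by (cases "k ((1, 1), 0, 0)") (simp flip: zero_prod_def)
  have d: "m dvd b" "m dvd a + (b - 1)" "m dvd c + d" "m dvd d - 1" "m dvd c - a"
    using eq unfolding k0 k1 w2 w3 by (simp_all add: zero_prod_def mod_eq_0_iff_dvd)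
  \<comment> \<open>All unknowns cancel in this combination, and the constant \<open>2\<close> remains.\<close>
  have "m dvd (c + d) - (d - 1) - (c - a) - (a + (b - 1)) + b"
    by (rule dvd_add[OF dvd_diff[OF dvd_diff[OF dvd_diff[OF d(3,4)] d(5)] d(2)] d(1)])
  then have "m dvd 2" by simp
  then have "m = 2" using m(1) zdvd_imp_le[of m 2] by simp
  then show False using m(2) by simp
qed

section \<open>The scheme is separable\<close>

locale klein_scheme_isomorphism =
  scheme_isomorphism "points m" "klein_scheme m" \<Omega>' S' \<phi>
  for m and \<Omega>' :: "'b set" and S' \<phi> +
  assumes m_pos: "m > 0" and m_odd: "odd m"
begin

text \<open>An arrow labelled \<open>g\<close> says that two points of the second configuration are related like
  two points of the scheme that differ by \<open>g\<close>. The label matters only through its colour.\<close>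

definition arrow :: "vec \<Rightarrow> 'b \<Rightarrow> 'b \<Rightarrow> bool" where
  "arrow g u v \<longleftrightarrow> (u, v) \<in> \<phi> (basis_relation m g)"

lemma basis: "basis_relation m g \<in> klein_scheme m"
  by (simp add: klein_scheme_def)

lemma arrow_cong: "colour m g = colour m h \<Longrightarrow> arrow g u v \<longleftrightarrow> arrow h u v"
  using basis_relation_eq_iff[OF m_pos] unfolding arrow_def by metis

lemma arrow_unique: "\<lbrakk>arrow g u v; arrow h u v\<rbrakk> \<Longrightarrow> colour m g = colour m h"
  using basis_relation_eq_iff[OF m_pos] eq_if_images_meet[OF basis basis] unfolding arrow_def by metis

lemma arrow_total: "\<lbrakk>u \<in> \<Omega>'; v \<in> \<Omega>'\<rbrakk> \<Longrightarrow> \<exists>g. arrow g u v"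
  using image_covers unfolding arrow_def klein_scheme_def by blast

lemma arrow_in: "arrow g u v \<Longrightarrow> u \<in> \<Omega>' \<and> v \<in> \<Omega>'"
  using X'.basis_subset[OF image_basis[OF basis]] unfolding arrow_def by blast

lemma arrow_zero: "arrow 0 u v \<longleftrightarrow> u \<in> \<Omega>' \<and> u = v"
proof -
  have "\<phi> (basis_relation m 0) = Id_on \<Omega>'" using image_diagonal by (simp add: Id_on_points)
  then show ?thesis by (auto simp: arrow_def)
qed

lemma arrow_split:
  assumes "arrow (g + h) u w"
  shows "\<exists>v. arrow g u v \<and> arrow h v w"
proof -
  have "(reduce m 0, reduce m (g + h)) \<in> basis_relation m (g + h)"
    "(reduce m 0, reduce m g) \<in> basis_relation m g"
    "(reduce m g, reduce m (g + h)) \<in> basis_relation m h"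
    using m_pos by (simp_all add: basis_relation_def reduce_in_points)
  then show ?thesis
    using triangle_iff[OF basis basis basis] assms unfolding arrow_def by blast
qed

text \<open>The labels of two arrows cannot be added in general, since their sum is not determined
  by their colours; some labels with the same colours can.\<close>

lemma arrow_compose:
  assumes "arrow g u v" "arrow h v w"
  shows "\<exists>g' h'. colour m g' = colour m g \<and> colour m h' = colour m h \<and> arrow (g' + h') u w"
proof -
  obtain k where k: "arrow k u w" using arrow_total arrow_in assms by blast
  have "(reduce m 0, reduce m k) \<in> basis_relation m k"
    using m_pos by (simp add: basis_relation_def reduce_in_points)
  then obtain y where "(reduce m 0, y) \<in> basis_relation m g" "(y, reduce m k) \<in> basis_relation m h"
    using triangle_iff[OF basis basis basis] k assms unfolding arrow_def by blast
  then have "colour m y = colour m g" "colour m (k - y) = colour m h"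
    by (simp_all add: basis_relation_def)
  moreover have "arrow (y + (k - y)) u w" using k by simp
  ultimately show ?thesis by blast
qed

lemma arrow_compose_thin:
  assumes "arrow g u v" "arrow h v w" "fst g = 0 \<or> fst h = 0"
  shows "arrow (g + h) u w"
proof -
  obtain g' h' where gh: "colour m g' = colour m g" "colour m h' = colour m h" "arrow (g' + h') u w"
    using arrow_compose[OF assms(1,2)] by blast
  have "colour m (g' + h') = colour m (g + h)"
    using assms(3) colour_add_thin[OF gh(1,2)[symmetric]] colour_add_thin[OF gh(2,1)[symmetric]]
    by (auto simp: add.commute)
  then show ?thesis using gh(3) arrow_cong by blast
qed

lemma arrow_uminus: "arrow g u v \<Longrightarrow> arrow (- g) v u"
proof -
  assume *: "arrow g u v"
  have "(basis_relation m g)\<inverse> = basis_relation m (- g)"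
    by (rule converse_basis_relation)
  then show ?thesis using image_converse[OF basis] * unfolding arrow_def by metis
qed

lemma arrow_from: "u \<in> \<Omega>' \<Longrightarrow> \<exists>v. arrow g u v"
  using arrow_split[of g "- g" u u] arrow_zero by auto

lemma arrow_thin_unique:
  assumes "arrow g u v" "arrow g u w" "fst g = 0"
  shows "v = w"
  using arrow_compose_thin[OF arrow_uminus[OF assms(1)] assms(2)] assms(3) by (simp add: arrow_zero)

text \<open>Points of the scheme, one in each block. The forms vanish on all differences of
  anchors, except on the difference between blocks \<open>(0, 1)\<close> and \<open>(1, 1)\<close>, where the value is \<open>2 * q\<close>
  up to sign.\<close>

fun anchor :: "int \<Rightarrow> bit \<times> bit \<Rightarrow> vec" where
  "anchor q (i, j) = ((i, j),
     if j = 0 then 0 else if i = 0 then - q else q,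
     if i = 0 then 0 else - q)"

lemma fst_anchor [simp]: "fst (anchor q a) = a"
  by (cases a) simp

text \<open>Points \<open>\<omega> a\<close> of the second configuration that lie to each other like the anchors. Choosing them
  block by block along arrows with vanishing forms satisfies five of the six conditions.
  The sixth arrow, between the last two blocks, has some colour \<open>c\<close>, and the anchors are made
  to fit it by solving \<open>2 * q = c\<close> modulo \<open>m\<close>.\<close>

lemma anchors_exist: "\<exists>q \<omega>. \<forall>a b. arrow (anchor q b - anchor q a) (\<omega> a) (\<omega> b)"
proof -
  have "\<phi> (basis_relation m 0) \<noteq> {}"
    using image_basis[OF basis] X'.partition unfolding partition_on_def by metis
  then obtain w0 w where "(w0, w) \<in> \<phi> (basis_relation m 0)" by fast
  then have w0: "w0 \<in> \<Omega>'" using arrow_in unfolding arrow_def by blast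
  obtain w1 where w1: "arrow ((1, 0), 0, 0) w0 w1" using arrow_from[OF w0] by blast
  obtain w2 where w2: "arrow ((0, 1), 0, 0) w0 w2" "arrow ((1, 1), 0, 0) w2 w1"
    using arrow_split[of "((0, 1), 0, 0)" "((1, 1), 0, 0)"] w1 by auto
  obtain w3 where w3: "arrow ((1, 1), 0, 0) w0 w3" "arrow ((0, 1), 0, 0) w3 w1"
    using arrow_split[of "((1, 1), 0, 0)" "((0, 1), 0, 0)"] w1 by auto
  obtain g' h' where gh: "colour m g' = colour m (- ((0, 1), 0, 0))"
      "colour m h' = colour m ((1, 1), 0, 0)"
      "arrow (g' + h') w2 w3"
    using arrow_compose[OF arrow_uminus[OF w2(1)] w3(1)] by blast
  have "fst (g' + h') = (1, 0)"
    using arg_cong[OF gh(1), of fst] arg_cong[OF gh(2), of fst] by simp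
  then obtain c d where c: "g' + h' = ((1, 0), c, d)" by (cases "g' + h'") auto
  \<comment> \<open>As \<open>m\<close> is odd, \<open>(m + 1) div 2\<close> is the inverse of \<open>2\<close>.\<close>
  define q where "q = c * ((m + 1) div 2)"
  have "2 * q = c + c * m"
    using m_odd by (auto simp: q_def elim!: oddE simp: algebra_simps)
  then have q: "(2 * q) mod m = c mod m" by simp
  define \<omega> where "\<omega> = (\<lambda>(i :: bit, j :: bit).
    if i = 0 then if j = 0 then w0 else w2 else if j = 0 then w1 else w3)"
  have c': "arrow ((1, 0), c, d) w2 w3" using gh(3) c by simp
  have edges: "arrow (anchor q (1, 0) - anchor q (0, 0)) w0 w1"
      "arrow (anchor q (0, 1) - anchor q (0, 0)) w0 w2"
      "arrow (anchor q (1, 1) - anchor q (0, 0)) w0 w3"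
      "arrow (anchor q (1, 0) - anchor q (0, 1)) w2 w1"
      "arrow (anchor q (1, 0) - anchor q (1, 1)) w3 w1"
      "arrow (anchor q (1, 1) - anchor q (0, 1)) w2 w3"
    by (rule arrow_cong[THEN iffD1, OF _ w1] arrow_cong[THEN iffD1, OF _ w2(1)]
      arrow_cong[THEN iffD1, OF _ w3(1)] arrow_cong[THEN iffD1, OF _ w2(2)]
      arrow_cong[THEN iffD1, OF _ w3(2)] arrow_cong[THEN iffD1, OF _ c'],
      use q in simp)+
  note edges' = edges[THEN arrow_uminus, unfolded minus_diff_eq]
  have loops: "arrow 0 w0 w0" "arrow 0 w1 w1" "arrow 0 w2 w2" "arrow 0 w3 w3"
    using arrow_in w1 w2 w3 by (auto simp: arrow_zero)
  have "arrow (anchor q b - anchor q a) (\<omega> a) (\<omega> b)" for a b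
  proof -
    obtain i j k l where "a = (i, j)" "b = (k, l)" by (metis prod.exhaust)
    then show ?thesis
      using edges edges' loops by (cases i; cases j; cases k; cases l)
        (simp_all add: \<omega>_def del: anchor.simps)
  qed
  then show ?thesis by blast
qed

text \<open>From an anchor the points of its block are reached by thin arrows, which determine their end
  point and whose labels can be added. So the anchors extend to a unique map \<open>f\<close> that
  respects displacements inside the blocks, and it respects all colours, as the path from
  \<open>f x\<close> to \<open>f y\<close> over the two anchors has only one arrow that is not thin.\<close>

lemma induced:
  "\<exists>f. combinatorial_isomorphism (points m) (klein_scheme m) \<Omega>' S' f \<and>
     (\<forall>s \<in> klein_scheme m. \<phi> s = rel_image f s)"
proof -
  obtain q \<omega> where \<omega>: "arrow (anchor q b - anchor q a) (\<omega> a) (\<omega> b)" for a b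
    using anchors_exist by blast
  have "\<exists>y. arrow (x - anchor q (fst x)) (\<omega> (fst x)) y" for x
    using arrow_from arrow_in \<omega> by blast
  then obtain f where f: "arrow (x - anchor q (fst x)) (\<omega> (fst x)) (f x)" for x by metis
  have arrow_f: "arrow (y - x) (f x) (f y)" for x y
  proof -
    have "arrow (- (x - anchor q (fst x)) + (anchor q (fst y) - anchor q (fst x))) (f x) (\<omega> (fst y))"
      by (rule arrow_compose_thin[OF arrow_uminus[OF f] \<omega>]) simp
    from arrow_compose_thin[OF this f[of y]] show ?thesis by simp
  qed
  have onto: "\<exists>x \<in> points m. v = f x" if v: "v \<in> \<Omega>'" for v
  proof -
    \<comment> \<open>The block of \<open>v\<close> is read off at \<open>\<omega> 0\<close>; seen from the anchor of that block, \<open>v\<close> is a thin neighbour.\<close>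
    obtain z where z: "arrow z (\<omega> 0) v" using arrow_total arrow_in \<omega> v by blast
    define i where "i = fst z"
    obtain g' h' where gh: "colour m g' = colour m (anchor q 0 - anchor q i)" "colour m h' = colour m z"
        "arrow (g' + h') (\<omega> i) v"
      using arrow_compose[OF \<omega> z] by blast
    define x where "x = reduce m (anchor q i + (g' + h'))"
    have [simp]: "a + a = 0" for a :: "bit \<times> bit"
      by (cases a; cases "fst a"; cases "snd a") (auto simp: zero_prod_def)
    have "fst g' = - i" "fst h' = i"
      using arg_cong[OF gh(1), of fst] arg_cong[OF gh(2), of fst] by (simp_all add: i_def)
    then have fst: "fst (g' + h') = 0" "fst x = i" by (simp_all add: x_def)
    have "colour m (x - anchor q (fst x)) = colour m (g' + h')"
      unfolding fst by (simp add: x_def)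
    then have "arrow (g' + h') (\<omega> i) (f x)" using f[of x] arrow_cong fst by metis
    then have "v = f x" using arrow_thin_unique gh(3) fst(1) by blast
    then show ?thesis using reduce_in_points[OF m_pos] x_def by blast
  qed
  have "inj_on f (points m)"
  proof (rule inj_onI)
    fix x y assume xy: "x \<in> points m" "y \<in> points m" "f x = f y"
    have "arrow 0 (f x) (f y)" using arrow_f arrow_in xy(3) arrow_zero by metis
    then show "x = y" using arrow_unique arrow_f colour_eq_zero_iff xy(1,2) by metis
  qed
  moreover have "f ` points m = \<Omega>'" using onto arrow_f arrow_in by blast
  ultimately have bij: "bij_betw f (points m) \<Omega>'" by (simp add: bij_betw_def)
  have image: "\<phi> s = rel_image f s" if s: "s \<in> klein_scheme m" for s
  proof -
    obtain g where g: "s = basis_relation m g" using s unfolding klein_scheme_def by blast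
    have iff: "arrow g (f x) (f y) \<longleftrightarrow> colour m (y - x) = colour m g" for x y
      using arrow_f arrow_unique arrow_cong by metis
    show ?thesis
    proof (intro equalityI subsetI)
      fix z assume "z \<in> \<phi> s"
      then obtain u v where z: "z = (u, v)" "arrow g u v" by (cases z) (auto simp: arrow_def g)
      then obtain x y where "x \<in> points m" "y \<in> points m" "u = f x" "v = f y"
        using onto arrow_in by metis
      with z iff have "(x, y) \<in> s" by (simp add: g basis_relation_def)
      then show "z \<in> rel_image f s" using z \<open>u = f x\<close> \<open>v = f y\<close> by (force simp: rel_image_def)
    next
      fix z assume "z \<in> rel_image f s"
      then show "z \<in> \<phi> s" using iff by (auto simp: rel_image_def g basis_relation_def arrow_def)
    qed
  qed
  have "rel_image f ` klein_scheme m = \<phi> ` klein_scheme m" using image by (simp cong: image_cong)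
  also have "\<dots> = S'" using iso by (auto simp: algebraic_isomorphism_def bij_betw_def)
  finally show ?thesis using bij image by (auto simp: combinatorial_isomorphism_def)
qed

end

lemma separable_klein_scheme:
  assumes "m > 0" "odd m"
  shows "separable (points m) (klein_scheme m)"
  unfolding separable_def
proof (intro allI impI)
  fix \<Omega>' :: "nat set" and S' \<phi>
  assume "coherent_configuration \<Omega>' S'" "algebraic_isomorphism (klein_scheme m) S' \<phi>"
  then interpret klein_scheme_isomorphism m \<Omega>' S' \<phi>
    using association_scheme_klein_scheme assms
    by (simp add: klein_scheme_isomorphism_def scheme_isomorphism_def scheme_isomorphism_axioms_def
        klein_scheme_isomorphism_axioms_def)
  show "\<exists>f. combinatorial_isomorphism (points m) (klein_scheme m) \<Omega>' S' f \<and>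
     (\<forall>s \<in> klein_scheme m. \<phi> s = rel_image f s)" by (rule induced)
qed

section \<open>Nonschurian separable schemes of degree \<open>4 * p ^ 2\<close>\<close>

theorem theorem1:
  fixes p :: nat
  assumes "prime p" and "p \<ge> 5"
  shows "\<exists>(\<Omega> :: nat set) S. association_scheme \<Omega> S \<and> card \<Omega> = 4 * p ^ 2 \<and>
           \<not> schurian \<Omega> S \<and> separable \<Omega> S"
proof -
  define m where "m = int p"
  have m: "m > 1" "odd m" using assms prime_odd_nat[of p] by (auto simp: m_def)
  interpret X: association_scheme "points m" "klein_scheme m"
    using association_scheme_klein_scheme m by simp
  obtain g :: "vec \<Rightarrow> nat" where g: "bij_betw g (points m) {0..<4 * p ^ 2}"
    using ex_bij_betw_finite_nat[OF finite_points[of m]] card_points[of m] by (auto simp: m_def)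
  let ?\<Omega> = "{0..<4 * p ^ 2}" and ?S = "rel_image g ` klein_scheme m"
  have "\<not> schurian ?\<Omega> ?S"
  proof
    assume schur: "schurian ?\<Omega> ?S"
    let ?o = "((0, 0), 0, 0) :: vec" and ?u = "((1, 0), 0, 0) :: vec" and ?v = "((1, 0), 0, 1) :: vec"
    let ?r = "basis_relation m ?u"
    have r: "?r \<in> klein_scheme m" by (simp add: klein_scheme_def)
    have "(?o, ?u) \<in> ?r" "(?o, ?v) \<in> ?r" using m by (simp_all add: basis_relation_def points_def zero_prod_def)
    then obtain k where "k ?o = ?o" "k ?u = ?v" "\<forall>t \<in> klein_scheme m. \<forall>(x, y) \<in> t. (k x, k y) \<in> t"
      using X.schurian_copy_homogeneous[OF g schur r] by blast
    then show False using klein_scheme_not_homogeneous[OF m, of k] by blast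
  qed
  moreover have "separable ?\<Omega> ?S"
    using X.separable_transport[OF g] separable_klein_scheme[of m] m by simp
  ultimately show ?thesis
    using X.transport_association_scheme[OF g] by (intro exI[of _ ?\<Omega>] exI[of _ ?S]) simp
qed

end
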